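(* Let $\lambda:[0,1]\to\mathbb{R}$ be monotone and differentiable on $[0,1]$ with $\inf_{t}|\lambda'(t)|>0$ and $\sup_t|\lambda'(t)|<\infty$. Let $\Lambda(t)=\int_0^t\lambda(u)\,du$, let $\Lambda_n$ ($n\ge1$) be cadlag step processes on $[0,1]$, let $M_n=\Lambda_n-\Lambda$, and let $\hat\lambda_n$ be the monotone estimator of $\lambda$ based on $\Lambda_n$. Assume there exists $C>0$ (not depending on $n$) such that the inequality $$\mathbb{E}\Big[\sup_{u\in[0,1],\ x/2\le|t-u|\le x}(M_n(u)-M_n(t))^2\Big]\le\frac{Cx}{n}$$ holds for all $n$, all $x\ge n^{-1/3}$ and all $t\in[0,1]$, and also holds for all $n$, all $x>0$ and $t\in\{0,1\}$. Let $p\in[1,2)$. Then, as $n\to\infty$, $$\mathbb{E}\Big[\int_0^1|\hat\lambda_n(t)-\lambda(t)|^p\,dt\Big]=O(n^{-p/3}).$$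
   Context: Cadlag means right continuous with left-hand limits at every point; a cadlag step process is a random, piecewise constant cadlag function. If $\lambda$ is nonincreasing (resp. nondecreasing), the monotone estimator $\hat\lambda_n$ based on $\Lambda_n$ is the left-hand slope (left derivative) of the least concave majorant (resp. greatest convex minorant) of $\Lambda_n$ on $[0,1]$, with $\hat\lambda_n(0)=\lim_{t\downarrow0}\hat\lambda_n(t)$. A supremum over an empty set of squares is taken to be $0$. *)

theory Defs
  imports "HOL-Probability.Probability" "HOL-Library.Landau_Symbols"
begin

definition cadlag_on_unit :: "(real \<Rightarrow> real) \<Rightarrow> bool" where
  "cadlag_on_unit f \<longleftrightarrow>
     (\<forall>t\<in>{0..<1}. (f \<longlongrightarrow> f t) (at_right t)) \<and>
     (\<forall>t\<in>{0<..1}. \<exists>l. (f \<longlongrightarrow> l) (at_left t))"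

(* S collects the break points; the values at the break points are unconstrained here. *)
definition piecewise_constant_on_unit :: "(real \<Rightarrow> real) \<Rightarrow> bool" where
  "piecewise_constant_on_unit f \<longleftrightarrow>
     (\<exists>S. finite S \<and>
        (\<forall>a b. {a<..<b} \<subseteq> {0..1} - S \<longrightarrow> f constant_on {a<..<b}))"

definition cadlag_step_process :: "'a measure \<Rightarrow> ('a \<Rightarrow> real \<Rightarrow> real) \<Rightarrow> bool" where
  "cadlag_step_process P X \<longleftrightarrow>
     (\<forall>t\<in>{0..1}. (\<lambda>\<omega>. X \<omega> t) \<in> borel_measurable P) \<and>
     (\<forall>\<omega>\<in>space P. cadlag_on_unit (X \<omega>) \<and> piecewise_constant_on_unit (X \<omega>))"

(* Both envelopes are meaningful for f bounded on the unit interval, evaluated inside it: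
   the pointwise infimum (supremum) is then a finite real and is itself concave (convex). *)
definition least_concave_majorant :: "(real \<Rightarrow> real) \<Rightarrow> real \<Rightarrow> real" where
  "least_concave_majorant f t =
     Inf {g t |g. concave_on {0..1} g \<and> (\<forall>s\<in>{0..1}. f s \<le> g s)}"

definition greatest_convex_minorant :: "(real \<Rightarrow> real) \<Rightarrow> real \<Rightarrow> real" where
  "greatest_convex_minorant f t =
     Sup {g t |g. convex_on {0..1} g \<and> (\<forall>s\<in>{0..1}. g s \<le> f s)}"

(* At 0 the value is the limit from the right.  At 1 the left derivative need not be finite
   (the envelope can jump there if f does), and then the value at 1 is arbitrary. *)
definition left_slope :: "(real \<Rightarrow> real) \<Rightarrow> real \<Rightarrow> real" where
  "left_slope G t =
     (if t = 0 then Lim (at_right 0) (\<lambda>s. vector_derivative G (at_left s))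
      else vector_derivative G (at_left t))"

(* The monotone estimator, based on F, of a monotone function l.  The direction of l decides
   between the two envelopes; only a constant l is monotone in both directions. *)
definition monotone_estimator :: "(real \<Rightarrow> real) \<Rightarrow> (real \<Rightarrow> real) \<Rightarrow> real \<Rightarrow> real" where
  "monotone_estimator l F =
     (if antimono_on {0..1} l then left_slope (least_concave_majorant F)
      else left_slope (greatest_convex_minorant F))"

end

(* The left slope h of the least concave majorant of F at t is the slope of a line that majorizes F
   and is minimal at t among all affine majorants. Rotating this line shows that, for s < r < t,
   h is at most the largest slope of F from s to a point u >= r. With F = Lambda + M and Lambda
   concave, this slope is at most lambda(s) + |M(u) - M(s)| / (u - s), and summing the moment bound
   over dyadic annuli around s gives a second moment of order 1 / (n (r - s)) for the supremum.
   With delta = n^(-1/3), points t in (k delta, (k+1) delta], k >= 1, use s = (k-1) delta and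
   r = k delta, with an error of order delta; points t <= delta use s = 0 and r comparable to t,
   with an error of order (n t)^(-1/2), whose p-th power is integrable at 0 since p < 2.
   The lower bound on h follows by the reflection t -> 1 - t, the nondecreasing case by a change
   of sign. *)
theory Submission
  imports Defs
begin

section \<open>Envelopes and supporting lines\<close>

text \<open>Chord slopes to the left of \<open>t\<close> increase and stay below every chord slope
  to the right. Their supremum is therefore both the left derivative and the slope of a line
  touching \<open>f\<close> at \<open>t\<close> from below.\<close>

lemma convex_left_derivative:
  fixes f :: "real \<Rightarrow> real"
  assumes f: "convex_on {a..b} f" and t: "a < t" "t < b"
  obtains d where "(f has_real_derivative d) (at_left t)"
    and "\<And>u. u \<in> {a..b} \<Longrightarrow> f t + d * (u - t) \<le> f u"
proof -
  define q where "q s = (f s - f t) / (s - t)" for s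
  define d where "d = Sup (q ` {a..<t})"
  have mono: "q r \<le> q s" if "a \<le> r" "r < s" "s < t" for r s
    using convex_on_slope_le(2)[OF f, of r t s] that t by (auto simp: q_def)
  have cross: "q s \<le> q u" if "a \<le> s" "s < t" "t < u" "u \<le> b" for s u
  proof -
    have "(f s - f t) / (s - t) \<le> (f s - f u) / (s - u)"
      and "(f s - f u) / (s - u) \<le> (f t - f u) / (t - u)"
      using convex_on_slope_le[OF f, of s u t] that t by auto
    moreover have "(f t - f u) / (t - u) = q u"
      unfolding q_def by (metis minus_diff_eq minus_divide_divide)
    ultimately show ?thesis by (simp add: q_def)
  qed
  have ne: "q ` {a..<t} \<noteq> {}" using t by auto
  have bdd: "bdd_above (q ` {a..<t})"
    using cross[where u = b] t by (intro bdd_aboveI[of _ "q b"]) auto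
  have le_d: "q s \<le> d" if "a \<le> s" "s < t" for s
    unfolding d_def using bdd that by (intro cSup_upper) auto
  have d_le: "d \<le> q u" if "t < u" "u \<le> b" for u
    unfolding d_def using ne cross that by (intro cSup_least) auto
  have "(q \<longlongrightarrow> d) (at_left t)"
  proof (rule order_tendstoI)
    fix y assume "y < d"
    then obtain s where s: "s \<in> {a..<t}" "y < q s"
      unfolding d_def using less_cSup_iff[OF ne bdd] by auto
    show "\<forall>\<^sub>F x in at_left t. y < q x"
      unfolding eventually_at_left_field
      by (rule exI[of _ s]) (use s mono in \<open>auto intro: less_le_trans\<close>)
  next
    fix y assume "d < y"
    show "\<forall>\<^sub>F x in at_left t. q x < y"
      unfolding eventually_at_left_field
      by (rule exI[of _ a]) (use t \<open>d < y\<close> le_less_trans[OF le_d] in auto)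
  qed
  then have "(f has_real_derivative d) (at_left t)"
    unfolding has_field_derivative_iff q_def .
  moreover have "f t + d * (u - t) \<le> f u" if "u \<in> {a..b}" for u
  proof (cases u t rule: linorder_cases)
    case less
    with le_d[of u] that show ?thesis
      by (auto simp: q_def divide_le_eq le_divide_eq field_simps split: if_splits)
  next
    case greater
    with d_le[of u] that show ?thesis
      by (auto simp: q_def divide_le_eq le_divide_eq field_simps split: if_splits)
  qed auto
  ultimately show thesis by (rule that)
qed

section \<open>The least concave majorant\<close>

context
  fixes F :: "real \<Rightarrow> real"
  assumes bdd: "bdd_above (F ` {0..1})"
begin

lemma concave_majorants_nonempty:
  "{g t |g. concave_on {0..1} g \<and> (\<forall>s\<in>{0..1}. F s \<le> g s)} \<noteq> {}"
proof -
  obtain B where "\<forall>s\<in>{0..1}. F s \<le> B" using bdd by (auto simp: bdd_above_def)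
  then show ?thesis by (auto simp: concave_on_const intro!: exI[of _ "\<lambda>_. B"])
qed

lemma least_concave_majorant_le:
  assumes "concave_on {0..1} g" "\<forall>s\<in>{0..1}. F s \<le> g s" "t \<in> {0..1}"
  shows "least_concave_majorant F t \<le> g t"
  unfolding least_concave_majorant_def
  using assms by (intro cInf_lower) (auto intro!: bdd_belowI[of _ "F t"])

lemma least_concave_majorant_ge:
  assumes "t \<in> {0..1}"
  shows "F t \<le> least_concave_majorant F t"
  unfolding least_concave_majorant_def
  using concave_majorants_nonempty assms by (intro cInf_greatest) auto

text \<open>A pointwise infimum of concave functions is concave: each competitor dominates the chord
  of the infimum, and the infimum over competitors comes last.\<close>

lemma concave_on_least_concave_majorant: "concave_on {0..1} (least_concave_majorant F)"
  unfolding concave_on_iff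
proof (intro conjI ballI allI impI)
  fix x y u v :: real
  assume xy: "x \<in> {0..1}" "y \<in> {0..1}" and uv: "0 \<le> u" "0 \<le> v" "u + v = 1"
  let ?G = "least_concave_majorant F"
  have "u * ?G x + v * ?G y \<le> g (u *\<^sub>R x + v *\<^sub>R y)"
    if g: "concave_on {0..1} g" "\<forall>s\<in>{0..1}. F s \<le> g s" for g
  proof -
    have "u * ?G x + v * ?G y \<le> u * g x + v * g y"
      using g xy uv by (intro add_mono mult_left_mono least_concave_majorant_le) auto
    also have "\<dots> \<le> g (u *\<^sub>R x + v *\<^sub>R y)"
      using g(1) xy uv by (auto simp: concave_on_iff)
    finally show ?thesis .
  qed
  then show "u * ?G x + v * ?G y \<le> ?G (u *\<^sub>R x + v *\<^sub>R y)"
    unfolding least_concave_majorant_def[of F "u *\<^sub>R x + v *\<^sub>R y"]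
    using concave_majorants_nonempty by (intro cInf_greatest) auto
qed auto

end

text \<open>Unlike a left derivative, this notion is invariant under the reflection \<open>u \<mapsto> 1 - u\<close>.\<close>

definition supporting_slope :: "(real \<Rightarrow> real) \<Rightarrow> real \<Rightarrow> real \<Rightarrow> bool" where
  "supporting_slope F t h \<longleftrightarrow>
     (\<exists>b. (\<forall>u\<in>{0..1}. F u \<le> b + h * (u - t)) \<and>
          (\<forall>a c. (\<forall>u\<in>{0..1}. F u \<le> c + a * (u - t)) \<longrightarrow> b \<le> c))"

text \<open>Since the slope changes sign, an upper bound in the reflected problem is a lower bound
  for \<open>h\<close>.\<close>

lemma supporting_slope_reflect:
  assumes "supporting_slope F t h"
  shows "supporting_slope (\<lambda>u. F (1 - u)) (1 - t) (- h)"
proof -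
  obtain b where b: "\<forall>u\<in>{0..1}. F u \<le> b + h * (u - t)"
    and least: "\<And>a c. \<forall>u\<in>{0..1}. F u \<le> c + a * (u - t) \<Longrightarrow> b \<le> c"
    using assms unfolding supporting_slope_def by blast
  have "F (1 - u) \<le> b + - h * (u - (1 - t))" if "u \<in> {0..1}" for u
    using b[rule_format, of "1 - u"] that by (simp add: algebra_simps)
  moreover have "b \<le> c" if *: "\<forall>u\<in>{0..1}. F (1 - u) \<le> c + a * (u - (1 - t))" for a c
  proof (rule least[of c "- a"], rule ballI)
    fix u :: real assume "u \<in> {0..1}"
    with *[rule_format, of "1 - u"] show "F u \<le> c + - a * (u - t)"
      by (simp add: algebra_simps)
  qed
  ultimately show ?thesis unfolding supporting_slope_def by blast
qed

section \<open>From the estimator to supporting slopes\<close>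

text \<open>The left tangent of the envelope lies above the envelope, hence above \<open>F\<close>.
  Conversely, an affine majorant of \<open>F\<close> is concave and so lies above the envelope,
  which makes the tangent minimal at \<open>t\<close>.\<close>

lemma least_concave_majorant_left_derivative:
  assumes bdd: "bdd_above (F ` {0..1})" and t: "0 < t" "t < 1"
  obtains d where "(least_concave_majorant F has_vector_derivative d) (at_left t)"
    and "supporting_slope F t d"
proof -
  let ?G = "least_concave_majorant F"
  have "convex_on {0..1} (\<lambda>x. - ?G x)"
    using concave_on_least_concave_majorant[OF bdd] by (simp add: concave_on_def)
  then obtain d where d: "((\<lambda>x. - ?G x) has_real_derivative d) (at_left t)"
    and sup: "\<And>u. u \<in> {0..1} \<Longrightarrow> - ?G t + d * (u - t) \<le> - ?G u"
    using convex_left_derivative t by metis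
  have "(?G has_real_derivative - d) (at_left t)"
    using DERIV_minus[OF d] by simp
  moreover have "supporting_slope F t (- d)"
    unfolding supporting_slope_def
  proof (rule exI[of _ "?G t"], intro conjI ballI allI impI)
    fix u :: real assume "u \<in> {0..1}"
    with sup[of u] least_concave_majorant_ge[OF bdd, of u]
    show "F u \<le> ?G t + - d * (u - t)" by simp
  next
    fix a c assume *: "\<forall>u\<in>{0..1}. F u \<le> c + a * (u - t)"
    have "concave_on {0..1} (\<lambda>u. c + a * (u - t))"
      unfolding concave_on_iff
    proof (intro conjI ballI allI impI)
      fix x y p q :: real assume "p + q = 1"
      then have q: "q = 1 - p" by simp
      show "p * (c + a * (x - t)) + q * (c + a * (y - t)) \<le> c + a * (p *\<^sub>R x + q *\<^sub>R y - t)"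
        by (simp add: q algebra_simps)
    qed simp
    from least_concave_majorant_le[OF bdd this *, of t] t show "?G t \<le> c" by simp
  qed
  ultimately show thesis
    by (intro that) (auto simp: has_real_derivative_iff_has_vector_derivative)
qed

lemma left_slope_eqI:
  assumes "(G has_vector_derivative d) (at_left t)" "t \<noteq> 0"
  shows "left_slope G t = d"
  using assms by (simp add: left_slope_def vector_derivative_within)

text \<open>Negation matches convex minorants of \<open>F\<close> with concave majorants of
  \<open>- F\<close>. The identity holds for every \<open>F\<close>, bounded or not, because
  \<open>Inf\<close> on the reals is defined by negating \<open>Sup\<close>.\<close>

lemma greatest_convex_minorant_eq:
  "greatest_convex_minorant F t = - least_concave_majorant (\<lambda>u. - F u) t"
proof -
  have "{g t |g. concave_on {0..1} g \<and> (\<forall>s\<in>{0..1}. - F s \<le> g s)} =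
        uminus ` {g t |g. convex_on {0..1} g \<and> (\<forall>s\<in>{0..1}. g s \<le> F s)}"
    (is "?A = uminus ` ?B")
  proof (intro equalityI subsetI)
    fix x assume "x \<in> ?A"
    then obtain g where g: "x = g t" "concave_on {0..1} g" "\<forall>s\<in>{0..1}. - F s \<le> g s" by blast
    then have "- x \<in> ?B"
      by (intro CollectI exI[of _ "\<lambda>s. - g s"]) (auto simp: concave_on_def minus_le_iff)
    then show "x \<in> uminus ` ?B" by force
  next
    fix x assume "x \<in> uminus ` ?B"
    then obtain g where g: "x = - g t" "convex_on {0..1} g" "\<forall>s\<in>{0..1}. g s \<le> F s" by blast
    then show "x \<in> ?A"
      by (intro CollectI exI[of _ "\<lambda>s. - g s"]) (auto simp: concave_on_def)
  qed
  then show ?thesis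
    by (simp add: least_concave_majorant_def greatest_convex_minorant_def Inf_real_def image_image)
qed

text \<open>From here on the estimator enters only through \<open>supporting_slope\<close>; the next
  lemma does the same for \<open>- F\<close> when the convex minorant is in use.\<close>

lemma monotone_estimator_antimono:
  assumes "antimono_on {0..1} l" "bdd_above (F ` {0..1})" "0 < t" "t < 1"
  shows "supporting_slope F t (monotone_estimator l F t)"
  using least_concave_majorant_left_derivative[OF assms(2-4)] left_slope_eqI assms
  by (metis less_irrefl monotone_estimator_def)

lemma monotone_estimator_not_antimono:
  assumes "\<not> antimono_on {0..1} l" "bdd_above ((\<lambda>u. - F u) ` {0..1})" "0 < t" "t < 1"
  shows "supporting_slope (\<lambda>u. - F u) t (- monotone_estimator l F t)"
proof -
  obtain d where d: "(least_concave_majorant (\<lambda>u. - F u) has_vector_derivative d) (at_left t)"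
    and s: "supporting_slope (\<lambda>u. - F u) t d"
    using least_concave_majorant_left_derivative[OF assms(2-4)] .
  have "greatest_convex_minorant F = (\<lambda>u. - least_concave_majorant (\<lambda>u. - F u) u)"
    by (rule ext) (rule greatest_convex_minorant_eq)
  then have "(greatest_convex_minorant F has_vector_derivative - d) (at_left t)"
    using has_vector_derivative_minus[OF d] by simp
  then have "left_slope (greatest_convex_minorant F) t = - d"
    using assms by (intro left_slope_eqI) auto
  then show ?thesis using assms s by (simp add: monotone_estimator_def)
qed

text \<open>Suprema over rational points are measurable; this condition makes them suffice. Right
  continuity implies it, but is not preserved by the reflection \<open>u \<mapsto> 1 - u\<close>.\<close>

definition rationally_approximable :: "(real \<Rightarrow> real) \<Rightarrow> bool" where
  "rationally_approximable f \<longleftrightarrow>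
     (\<forall>u\<in>{0..1}. \<forall>e>0. \<exists>d\<in>{0..1} \<inter> \<rat>. \<bar>d - u\<bar> < e \<and> \<bar>f d - f u\<bar> < e)"

lemma rationally_approximable_reflect:
  assumes "rationally_approximable f"
  shows "rationally_approximable (\<lambda>u. f (1 - u))"
  unfolding rationally_approximable_def
proof (intro ballI allI impI)
  fix u e :: real assume "u \<in> {0..1}" "0 < e"
  then obtain d where "d \<in> {0..1} \<inter> \<rat>" "\<bar>d - (1 - u)\<bar> < e" "\<bar>f d - f (1 - u)\<bar> < e"
    using assms[unfolded rationally_approximable_def, rule_format, of "1 - u" e] by auto
  then show "\<exists>d\<in>{0..1} \<inter> \<rat>. \<bar>d - u\<bar> < e \<and> \<bar>f (1 - d) - f (1 - u)\<bar> < e"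
    by (intro bexI[of _ "1 - d"]) auto
qed

lemma rationally_approximable_minus:
  "rationally_approximable f \<Longrightarrow> rationally_approximable (\<lambda>u. - f u)"
  unfolding rationally_approximable_def by (simp add: abs_minus_commute)

lemma rationally_approximable_affine_bound:
  assumes f: "rationally_approximable f"
    and le: "\<And>d. d \<in> {0..1} \<inter> \<rat> \<Longrightarrow> f d \<le> c + a * (d - t)"
    and u: "u \<in> {0..1}"
  shows "f u \<le> c + a * (u - t)"
proof (rule ccontr)
  assume not_le: "\<not> ?thesis"
  define g where "g = f u - (c + a * (u - t))"
  \<comment> \<open>Moving from \<open>u\<close> to a rational point within \<open>e\<close> changes
    \<open>f\<close> by less than \<open>e\<close> and the affine function by at most
    \<open>\<bar>a\<bar> * e\<close>, together less than the gap \<open>g\<close>.\<close>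
  define e where "e = g / (1 + \<bar>a\<bar>)"
  have "0 < g" using not_le by (simp add: g_def)
  then have e: "0 < e" "e * (1 + \<bar>a\<bar>) = g"
    by (auto simp: e_def add_pos_nonneg zero_less_divide_iff)
  then obtain d where d: "d \<in> {0..1} \<inter> \<rat>" "\<bar>d - u\<bar> < e" "\<bar>f d - f u\<bar> < e"
    using f u unfolding rationally_approximable_def by blast
  have "a * (d - u) \<le> \<bar>a\<bar> * \<bar>d - u\<bar>" by (metis abs_ge_self abs_mult)
  also have "\<dots> \<le> \<bar>a\<bar> * e" using d by (intro mult_left_mono) auto
  finally have "a * (d - t) \<le> a * (u - t) + \<bar>a\<bar> * e" by (simp add: algebra_simps)
  with le[OF d(1)] d(3) e(2) show False by (simp add: g_def algebra_simps)
qed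

text \<open>This is the upper half of the min-max formula for the slope of a concave majorant.\<close>

lemma supporting_slope_le:
  assumes F: "rationally_approximable F" and h: "supporting_slope F t h"
    and s: "0 \<le> s" "s \<le> r" "r < t" "t \<le> 1"
    and le: "\<And>d. d \<in> {0..1} \<inter> \<rat> \<Longrightarrow> r \<le> d \<Longrightarrow> F d \<le> F s + a * (d - s)"
  shows "h \<le> a"
proof (rule ccontr)
  assume "\<not> h \<le> a"
  then have a: "a < h" by simp
  obtain b where b: "\<And>u. u \<in> {0..1} \<Longrightarrow> F u \<le> b + h * (u - t)"
    and least: "\<And>a c. \<forall>u\<in>{0..1}. F u \<le> c + a * (u - t) \<Longrightarrow> b \<le> c"
    using h unfolding supporting_slope_def by blast
  \<comment> \<open>Rotate the supporting line clockwise around its point over \<open>r\<close>.\<close>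
  define c where "c = b + (h - a) * (r - t)"
  have "F d \<le> c + a * (d - t)" if d: "d \<in> {0..1} \<inter> \<rat>" for d
  proof (cases "r \<le> d")
    \<comment> \<open>The line of slope \<open>a\<close> through the old line's point over
      \<open>s\<close> lies below the parallel rotated line, as \<open>a < h\<close> and
      \<open>s \<le> r\<close>.\<close>
    case True
    have "F d \<le> F s + a * (d - s)" using le d True by auto
    also have "\<dots> \<le> b + h * (s - t) + a * (d - s)" using b[of s] s by auto
    also have "\<dots> \<le> c + a * (d - t)"
      using mult_nonneg_nonneg[of "h - a" "r - s"] a s by (simp add: c_def algebra_simps)
    finally show ?thesis .
  next
    case False
    have "F d \<le> b + h * (d - t)" using b d by auto
    also have "\<dots> \<le> c + a * (d - t)"
      using mult_nonneg_nonneg[of "h - a" "r - d"] a False by (simp add: c_def algebra_simps)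
    finally show ?thesis .
  qed
  then have "b \<le> c"
    using rationally_approximable_affine_bound[OF F] by (intro least) blast
  \<comment> \<open>The pivot is left of \<open>t\<close>, so the rotation lowers the value at
    \<open>t\<close>, against the minimality of \<open>b\<close>.\<close>
  moreover have "(h - a) * (r - t) < 0" using a s by (intro mult_pos_neg) auto
  ultimately show False by (simp add: c_def)
qed

section \<open>Regularity of cadlag paths\<close>

text \<open>Right continuity provides rational points just to the right of \<open>u < 1\<close>; the
  remaining point 1 is itself rational.\<close>

lemma cadlag_rationally_approximable:
  assumes "cadlag_on_unit f"
  shows "rationally_approximable f"
  unfolding rationally_approximable_def
proof (intro ballI allI impI)
  fix u e :: real assume u: "u \<in> {0..1}" and e: "0 < e"
  show "\<exists>d\<in>{0..1} \<inter> \<rat>. \<bar>d - u\<bar> < e \<and> \<bar>f d - f u\<bar> < e"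
  proof (cases "u = 1")
    case True
    then show ?thesis using e by (intro bexI[of _ 1]) auto
  next
    case False
    then have "(f \<longlongrightarrow> f u) (at_right u)" using assms u by (auto simp: cadlag_on_unit_def)
    then have "\<forall>\<^sub>F x in at_right u. dist (f x) (f u) < e" using e by (auto dest: tendstoD)
    then obtain b where b: "u < b" "\<And>y. u < y \<Longrightarrow> y < b \<Longrightarrow> dist (f y) (f u) < e"
      unfolding eventually_at_right_field by blast
    obtain d where "d \<in> \<rat>" "u < d" "d < min b (min 1 (u + e))"
      using Rats_dense_in_real[of u "min b (min 1 (u + e))"] b e u False by auto
    then show ?thesis using b u by (intro bexI[of _ d]) (auto simp: dist_real_def)
  qed
qed

text \<open>One-sided limits bound \<open>f\<close> on both sides of each point, and bisection
  carries these local bounds to the whole interval.\<close>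

lemma cadlag_bounded:
  assumes "cadlag_on_unit f"
  shows "\<exists>B. \<forall>u\<in>{0..1}. \<bar>f u\<bar> \<le> B"
proof -
  \<comment> \<open>The intersection is there because the local condition of \<open>Bolzano\<close>
    also concerns intervals that stick out of \<open>{0..1}\<close>.\<close>
  define Q where "Q a b \<longleftrightarrow> (\<exists>B. \<forall>u\<in>{a..b} \<inter> {0..1}. \<bar>f u\<bar> \<le> B)" for a b :: real
  have lim: "\<exists>B. \<forall>\<^sub>F y in A. \<bar>f y\<bar> \<le> B" if "(f \<longlongrightarrow> l) A" for l A
  proof -
    have "\<forall>\<^sub>F y in A. dist (f y) l < 1" using that by (rule tendstoD) simp
    then have "\<forall>\<^sub>F y in A. \<bar>f y\<bar> \<le> \<bar>l\<bar> + 1"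
      by (rule eventually_mono) (auto simp: dist_real_def)
    then show ?thesis by blast
  qed
  have "(0::real) \<le> 1" by simp
  then have "Q 0 1"
  proof (induction rule: Bolzano)
    case (trans a b c)
    then obtain B B' where B: "\<And>u. u \<in> {a..b} \<inter> {0..1} \<Longrightarrow> \<bar>f u\<bar> \<le> B"
      "\<And>u. u \<in> {b..c} \<inter> {0..1} \<Longrightarrow> \<bar>f u\<bar> \<le> B'"
      unfolding Q_def by blast
    have "\<bar>f u\<bar> \<le> max B B'" if "u \<in> {a..c} \<inter> {0..1}" for u
    proof (cases "u \<le> b")
      case True
      then have "\<bar>f u\<bar> \<le> B" using that by (intro B) auto
      then show ?thesis by simp
    next
      case False
      then have "\<bar>f u\<bar> \<le> B'" using that by (intro B) auto
      then show ?thesis by simp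
    qed
    then show ?case unfolding Q_def by blast
  next
    case (local x)
    have "\<exists>B r. x < r \<and> (\<forall>y. x < y \<and> y < r \<and> y \<le> 1 \<longrightarrow> \<bar>f y\<bar> \<le> B)"
    proof (cases "x = 1")
      case True
      then show ?thesis by (intro exI[of _ 0] exI[of _ 2]) auto
    next
      case False
      then have "(f \<longlongrightarrow> f x) (at_right x)" using assms local by (auto simp: cadlag_on_unit_def)
      then obtain B where "\<forall>\<^sub>F y in at_right x. \<bar>f y\<bar> \<le> B" using lim by blast
      then show ?thesis unfolding eventually_at_right_field by blast
    qed
    then obtain B r where r: "x < r" "\<And>y. x < y \<Longrightarrow> y < r \<Longrightarrow> y \<le> 1 \<Longrightarrow> \<bar>f y\<bar> \<le> B" by blast
    have "\<exists>B l. l < x \<and> (\<forall>y. l < y \<and> y < x \<and> 0 \<le> y \<longrightarrow> \<bar>f y\<bar> \<le> B)"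
    proof (cases "x = 0")
      case True
      then show ?thesis by (intro exI[of _ 0] exI[of _ "-1"]) auto
    next
      case False
      then obtain c where "(f \<longlongrightarrow> c) (at_left x)"
        using assms local by (force simp: cadlag_on_unit_def)
      then obtain B where "\<forall>\<^sub>F y in at_left x. \<bar>f y\<bar> \<le> B" using lim by blast
      then show ?thesis unfolding eventually_at_left_field by blast
    qed
    then obtain B' l where l: "l < x" "\<And>y. l < y \<Longrightarrow> y < x \<Longrightarrow> 0 \<le> y \<Longrightarrow> \<bar>f y\<bar> \<le> B'" by blast
    have "Q a b" if ab: "a \<le> x" "x \<le> b" "b - a < min (r - x) (x - l)" for a b
      unfolding Q_def
    proof (intro exI ballI)
      fix u assume u: "u \<in> {a..b} \<inter> {0..1}"
      consider "u < x" | "u = x" | "x < u" by linarith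
      then have "\<bar>f u\<bar> \<le> B' \<or> u = x \<or> \<bar>f u\<bar> \<le> B"
        using r(2)[of u] l(2)[of u] ab u by cases auto
      then show "\<bar>f u\<bar> \<le> max \<bar>f x\<bar> (max B B')" by auto
    qed
    then show ?case using r(1) l(1) by (intro exI[of _ "min (r - x) (x - l)"]) auto
  qed
  then show ?thesis unfolding Q_def by auto
qed

section \<open>Second moments on deterministic cells\<close>

text \<open>Used with base 2 to find the dyadic annulus of a point, and with base 4 to find its cell
  near 0.\<close>

lemma power_bracket:
  fixes b x :: real
  assumes "1 < b" "1 \<le> x"
  obtains j :: nat where "b ^ j \<le> x" "x < b ^ Suc j"
proof -
  define k where "k = (LEAST k. x < b ^ k)"
  have "\<exists>k. x < b ^ k" using assms by (simp add: real_arch_pow)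
  then have k: "x < b ^ k" unfolding k_def by (rule LeastI_ex)
  then obtain j where j: "k = Suc j" using assms by (cases k) auto
  have "b ^ j \<le> x" using not_less_Least[of j "\<lambda>k. x < b ^ k"] j by (simp add: k_def not_less)
  with k j show thesis by (intro that) auto
qed

text \<open>Trades a \<open>p\<close>-th power for a second moment: below the threshold
  \<open>y\<close> the first term suffices, above it the exponent \<open>p - 2\<close> is
  nonpositive. If \<open>w\<close> has second moment of order \<open>y\<^sup>2\<close>, both terms
  have order \<open>y powr p\<close>.\<close>

lemma powr_le_truncated_square:
  fixes w y p :: real
  assumes "0 \<le> w" "0 < y" "0 \<le> p" "p \<le> 2"
  shows "w powr p \<le> y powr p + y powr (p - 2) * w\<^sup>2"
proof (cases "w \<le> y")
  case True
  then have "w powr p \<le> y powr p" using assms by (intro powr_mono2) auto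
  then show ?thesis by (simp add: add_increasing2)
next
  case False
  then have "w powr p = w powr (p - 2) * w\<^sup>2"
    using assms by (simp add: powr_numeral[symmetric] powr_add[symmetric] del: powr_numeral)
  also have "\<dots> \<le> y powr (p - 2) * w\<^sup>2"
    using False assms by (intro mult_right_mono powr_mono2') auto
  finally show ?thesis by (simp add: add_increasing)
qed

lemma ennreal_le_suminf: "f i \<le> (\<Sum>i. f i)" for f :: "nat \<Rightarrow> ennreal"
  using sum_le_suminf[of f "{i}"] by simp

text \<open>The integral of \<open>W\<close> over \<open>t\<close> is an explicit series of random
  variables, so its measurability and expectation follow termwise. The cells may overlap, since a
  series of nonnegative terms dominates each of them.\<close>

lemma step_majorant:
  fixes R :: "nat \<Rightarrow> 'a \<Rightarrow> ennreal" and a b c :: "nat \<Rightarrow> real"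
  assumes [measurable]: "\<And>i. R i \<in> borel_measurable P"
    and ab: "\<And>i. a i \<le> b i" and c: "\<And>i. 0 \<le> c i"
    and le: "\<And>i. (\<integral>\<^sup>+\<omega>. R i \<omega> \<partial>P) \<le> ennreal (c i)"
    and S: "(\<lambda>i. (b i - a i) * c i) sums S"
  obtains W :: "'a \<Rightarrow> real \<Rightarrow> ennreal" where "\<And>\<omega>. W \<omega> \<in> borel_measurable lborel"
    and "(\<lambda>\<omega>. \<integral>\<^sup>+t. W \<omega> t \<partial>lborel) \<in> borel_measurable P"
    and "(\<integral>\<^sup>+\<omega>. (\<integral>\<^sup>+t. W \<omega> t \<partial>lborel) \<partial>P) \<le> ennreal S"
    and "\<And>i \<omega> t. a i < t \<Longrightarrow> t \<le> b i \<Longrightarrow> R i \<omega> \<le> W \<omega> t"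
proof -
  define W where "W \<omega> t = (\<Sum>i. R i \<omega> * indicator {a i<..b i} t)" for \<omega> t
  have W: "(\<integral>\<^sup>+t. W \<omega> t \<partial>lborel) = (\<Sum>i. ennreal (b i - a i) * R i \<omega>)" for \<omega>
    unfolding W_def by (subst nn_integral_suminf) (auto simp: nn_integral_cmult ab mult.commute)
  have "(\<integral>\<^sup>+\<omega>. (\<integral>\<^sup>+t. W \<omega> t \<partial>lborel) \<partial>P) = (\<Sum>i. ennreal (b i - a i) * (\<integral>\<^sup>+\<omega>. R i \<omega> \<partial>P))"
    unfolding W by (subst nn_integral_suminf) (auto simp: nn_integral_cmult)
  also have "\<dots> \<le> (\<Sum>i. ennreal ((b i - a i) * c i))"
    using le ab c by (intro suminf_le) (auto simp: ennreal_mult intro: mult_left_mono)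
  also have "\<dots> = ennreal S"
    using ab c S by (intro suminf_ennreal_eq) auto
  finally have "(\<integral>\<^sup>+\<omega>. (\<integral>\<^sup>+t. W \<omega> t \<partial>lborel) \<partial>P) \<le> ennreal S" .
  moreover have "R i \<omega> \<le> W \<omega> t" if "a i < t" "t \<le> b i" for i \<omega> t
    using ennreal_le_suminf[of "\<lambda>i. R i \<omega> * indicator {a i<..b i} t" i] that by (simp add: W_def)
  moreover have "W \<omega> \<in> borel_measurable lborel" for \<omega>
    unfolding W_def by measurable
  moreover have "(\<lambda>\<omega>. \<integral>\<^sup>+t. W \<omega> t \<partial>lborel) \<in> borel_measurable P"
    unfolding W by measurable
  ultimately show thesis by (intro that)
qed

section \<open>Increments and cells at scale \<open>\<delta>\<close>\<close>

text \<open>A locale, so that the reflected data can be a second instance. Here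
  \<open>\<delta> ^ 3\<close> stands for \<open>1 / n\<close>, and \<open>tangent\<close> says that
  \<open>l\<close> is a supergradient of \<open>A\<close>.\<close>

locale increment_bound = prob_space P for P :: "'a measure" +
  fixes F :: "'a \<Rightarrow> real \<Rightarrow> real" and A l :: "real \<Rightarrow> real" and C L p \<delta> :: real
  assumes F_measurable: "t \<in> {0..1} \<Longrightarrow> (\<lambda>\<omega>. F \<omega> t) \<in> borel_measurable P"
    and F_approximable: "\<omega> \<in> space P \<Longrightarrow> rationally_approximable (F \<omega>)"
    and tangent: "s \<in> {0..1} \<Longrightarrow> u \<in> {0..1} \<Longrightarrow> A u - A s \<le> l s * (u - s)"
    and lipschitz: "s \<in> {0..1} \<Longrightarrow> t \<in> {0..1} \<Longrightarrow> \<bar>l s - l t\<bar> \<le> L * \<bar>s - t\<bar>"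
    and C: "0 < C" and L: "0 \<le> L" and p: "0 \<le> p" "p < 2" and \<delta>: "0 < \<delta>" "\<delta> \<le> 1"
    and moment: "t \<in> {0..1} \<Longrightarrow> \<delta> \<le> x \<or> 0 < x \<and> t \<in> {0, 1} \<Longrightarrow>
      (\<integral>\<^sup>+\<omega>. (SUP u\<in>{u\<in>{0..1}. x / 2 \<le> \<bar>t - u\<bar> \<and> \<bar>t - u\<bar> \<le> x}.
         ennreal (((F \<omega> u - A u) - (F \<omega> t - A t))\<^sup>2)) \<partial>P) \<le> ennreal (C * x * \<delta> ^ 3)"
begin

definition M :: "'a \<Rightarrow> real \<Rightarrow> real" where "M \<omega> u = F \<omega> u - A u"

text \<open>Rational indices keep the supremum measurable, and values in \<open>ennreal\<close>
  allow it to be infinite.\<close>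

definition max_slope_sq :: "real \<Rightarrow> real \<Rightarrow> 'a \<Rightarrow> ennreal" where
  "max_slope_sq s r \<omega> = (SUP d\<in>{r..1} \<inter> \<rat>. ennreal (((M \<omega> d - M \<omega> s) / (d - s))\<^sup>2))"

lemma M_measurable: "t \<in> {0..1} \<Longrightarrow> (\<lambda>\<omega>. M \<omega> t) \<in> borel_measurable P"
  using F_measurable by (simp add: M_def)

lemma max_slope_sq_measurable:
  assumes "0 \<le> s" "s < r" "r \<le> 1"
  shows "max_slope_sq s r \<in> borel_measurable P"
proof -
  have [measurable]: "(\<lambda>\<omega>. M \<omega> s) \<in> borel_measurable P" using assms by (intro M_measurable) auto
  have [measurable]: "(\<lambda>\<omega>. M \<omega> d) \<in> borel_measurable P" if "d \<in> {r..1} \<inter> \<rat>" for d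
    using assms that by (intro M_measurable) auto
  have "countable ({r..1} \<inter> \<rat>)" by (simp add: countable_rat countable_Int2)
  then show ?thesis unfolding max_slope_sq_def by measurable
qed

text \<open>Dyadic peeling: on the \<open>j\<close>-th annulus the squared slope is at most the
  squared increment over \<open>(2 ^ j * x)\<^sup>2\<close>, with expectation at most
  \<open>2 * C * \<delta> ^ 3 / x * (1 / 2) ^ j\<close>. The geometric sum contributes the second
  factor 2 of the constant 4.\<close>

lemma max_slope_sq_integral:
  assumes s: "0 \<le> s" "s < r" "r \<le> 1" and anchor: "s = 0 \<or> \<delta> \<le> r - s"
  shows "(\<integral>\<^sup>+\<omega>. max_slope_sq s r \<omega> \<partial>P) \<le> ennreal (4 * C * \<delta> ^ 3 / (r - s))"
proof -
  define x where "x = r - s"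
  have x: "0 < x" using s by (simp add: x_def)
  define D where "D j = {d \<in> {0..1} \<inter> \<rat>. 2 ^ j * x \<le> \<bar>s - d\<bar> \<and> \<bar>s - d\<bar> \<le> 2 ^ Suc j * x}" for j :: nat
  define T where "T j \<omega> = (SUP d\<in>D j. ennreal ((M \<omega> d - M \<omega> s)\<^sup>2))" for j \<omega>
  have D: "countable (D j)" for j
    unfolding D_def by (rule countable_subset[OF _ countable_rat]) auto
  have [measurable]: "(\<lambda>\<omega>. M \<omega> s) \<in> borel_measurable P" using s by (intro M_measurable) auto
  have [measurable]: "(\<lambda>\<omega>. M \<omega> d) \<in> borel_measurable P" if "d \<in> D j" for d j
    using that by (intro M_measurable) (auto simp: D_def)
  have T[measurable]: "T j \<in> borel_measurable P" for j
    unfolding T_def using D by measurable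
  have T_le: "(\<integral>\<^sup>+\<omega>. T j \<omega> \<partial>P) \<le> ennreal (C * (2 ^ Suc j * x) * \<delta> ^ 3)" for j
  proof -
    \<comment> \<open>The outer radius of the annulus takes the role of \<open>x\<close> in
      \<open>moment\<close>: it is at least \<open>\<delta>\<close> unless \<open>s = 0\<close>,
      where every positive radius is admissible.\<close>
    have "x \<le> 2 ^ Suc j * x" using x by (simp add: mult_le_cancel_right1 one_le_power del: power_Suc)
    moreover have "s = 0 \<or> \<delta> \<le> x" "0 < 2 ^ Suc j * x"
      using anchor x by (simp_all add: x_def)
    ultimately have "\<delta> \<le> 2 ^ Suc j * x \<or> 0 < 2 ^ Suc j * x \<and> s \<in> {0, 1}"
      by (metis insertI1 order_trans)
    then have "(\<integral>\<^sup>+\<omega>. (SUP u\<in>{u\<in>{0..1}. 2 ^ Suc j * x / 2 \<le> \<bar>s - u\<bar> \<and> \<bar>s - u\<bar> \<le> 2 ^ Suc j * x}.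
         ennreal ((M \<omega> u - M \<omega> s)\<^sup>2)) \<partial>P) \<le> ennreal (C * (2 ^ Suc j * x) * \<delta> ^ 3)"
      unfolding M_def using s by (intro moment) auto
    moreover have "T j \<omega> \<le> (SUP u\<in>{u\<in>{0..1}. 2 ^ Suc j * x / 2 \<le> \<bar>s - u\<bar> \<and> \<bar>s - u\<bar> \<le> 2 ^ Suc j * x}.
         ennreal ((M \<omega> u - M \<omega> s)\<^sup>2))" for \<omega>
      unfolding T_def by (rule SUP_subset_mono) (auto simp: D_def)
    ultimately show ?thesis
      by (rule order_trans[OF nn_integral_mono, rotated])
  qed
  have "max_slope_sq s r \<omega> \<le> (\<Sum>j. ennreal (1 / (2 ^ j * x)\<^sup>2) * T j \<omega>)" for \<omega>
    unfolding max_slope_sq_def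
  proof (rule SUP_least)
    fix d assume d: "d \<in> {r..1} \<inter> \<rat>"
    then have "1 \<le> (d - s) / x" using x by (simp add: x_def)
    then obtain j where j: "2 ^ j \<le> (d - s) / x" "(d - s) / x < 2 ^ Suc j"
      using power_bracket[of 2 "(d - s) / x"] by auto
    then have j': "2 ^ j * x \<le> d - s" "d - s \<le> 2 ^ Suc j * x"
      using x by (auto simp: field_simps)
    have pos: "0 < 2 ^ j * x" using x by simp
    have "((M \<omega> d - M \<omega> s) / (d - s))\<^sup>2 \<le> (M \<omega> d - M \<omega> s)\<^sup>2 / (2 ^ j * x)\<^sup>2"
      unfolding power_divide using j'(1) pos x s d
      by (intro divide_left_mono power_mono mult_pos_pos zero_less_power) auto
    then have "ennreal (((M \<omega> d - M \<omega> s) / (d - s))\<^sup>2) \<le> ennreal (1 / (2 ^ j * x)\<^sup>2) * ennreal ((M \<omega> d - M \<omega> s)\<^sup>2)"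
      by (simp add: ennreal_mult[symmetric] ennreal_leI)
    also have "ennreal ((M \<omega> d - M \<omega> s)\<^sup>2) \<le> T j \<omega>"
      unfolding T_def by (rule SUP_upper) (use d j' pos s in \<open>auto simp: D_def\<close>)
    also have "ennreal (1 / (2 ^ j * x)\<^sup>2) * T j \<omega> \<le> (\<Sum>j. ennreal (1 / (2 ^ j * x)\<^sup>2) * T j \<omega>)"
      by (rule ennreal_le_suminf)
    finally show "ennreal (((M \<omega> d - M \<omega> s) / (d - s))\<^sup>2) \<le> (\<Sum>j. ennreal (1 / (2 ^ j * x)\<^sup>2) * T j \<omega>)"
      by (simp add: mult_left_mono)
  qed
  then have "(\<integral>\<^sup>+\<omega>. max_slope_sq s r \<omega> \<partial>P) \<le> (\<integral>\<^sup>+\<omega>. (\<Sum>j. ennreal (1 / (2 ^ j * x)\<^sup>2) * T j \<omega>) \<partial>P)"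
    by (intro nn_integral_mono) auto
  also have "\<dots> = (\<Sum>j. ennreal (1 / (2 ^ j * x)\<^sup>2) * (\<integral>\<^sup>+\<omega>. T j \<omega> \<partial>P))"
    by (subst nn_integral_suminf) (auto simp: nn_integral_cmult)
  also have "\<dots> \<le> (\<Sum>j. ennreal (1 / (2 ^ j * x)\<^sup>2) * ennreal (C * (2 ^ Suc j * x) * \<delta> ^ 3))"
    using T_le by (intro suminf_le mult_left_mono) auto
  also have "\<dots> = (\<Sum>j. ennreal (2 * C * \<delta> ^ 3 / x * (1 / 2) ^ j))"
    using x C \<delta> by (intro suminf_cong)
      (simp add: ennreal_mult[symmetric] power_divide power2_eq_square field_simps)
  also have "\<dots> = ennreal (2 * C * \<delta> ^ 3 / x * 2)"
  proof (rule suminf_ennreal_eq)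
    show "(\<lambda>j. 2 * C * \<delta> ^ 3 / x * (1 / 2) ^ j) sums (2 * C * \<delta> ^ 3 / x * 2)"
      using geometric_sums[of "1 / 2 :: real"] by (intro sums_mult) simp
  qed (use x C \<delta> in simp)
  finally show ?thesis by (simp add: x_def mult.assoc)
qed

text \<open>A bound, valid on all of a cell \<open>(a, b]\<close>, for the \<open>p\<close>-th power of the positive part of the
  error; it comes from \<open>w\<^sup>p \<le> y\<^sup>p + y\<^sup>p\<^sup>-\<^sup>2 w\<^sup>2\<close>. Since the cells are deterministic, no joint measurability
  in \<open>(\<omega>, t)\<close> is ever needed.\<close>

definition cell_bound :: "real \<Rightarrow> real \<Rightarrow> real \<Rightarrow> 'a \<Rightarrow> ennreal" where
  "cell_bound s a y \<omega> = ennreal (y powr p) +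
     ennreal (y powr (p - 2)) * (2 * max_slope_sq s a \<omega> + ennreal (8 * (L * \<delta>)\<^sup>2))"

lemma cell_bound_measurable:
  assumes "0 \<le> s" "s < a" "a \<le> 1"
  shows "cell_bound s a y \<in> borel_measurable P"
proof -
  note [measurable] = max_slope_sq_measurable[OF assms]
  show ?thesis unfolding cell_bound_def by measurable
qed

text \<open>The second condition on \<open>y\<close> puts it above the noise level
  \<open>sqrt (\<delta> ^ 3 / (a - s))\<close> of the slopes, the first above the drift of
  \<open>l\<close> up to the factor \<open>L\<close>; hence every term has order
  \<open>y powr p\<close>.\<close>

lemma cell_bound_integral:
  assumes s: "0 \<le> s" "s < a" "a \<le> 1" and anchor: "s = 0 \<or> \<delta> \<le> a - s"
    and y: "\<delta> \<le> y" "\<delta> ^ 3 \<le> y\<^sup>2 * (a - s)"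
  shows "(\<integral>\<^sup>+\<omega>. cell_bound s a y \<omega> \<partial>P) \<le> ennreal ((1 + 8 * C + 8 * L\<^sup>2) * y powr p)"
proof -
  note [measurable] = max_slope_sq_measurable[OF s]
  have "(\<integral>\<^sup>+\<omega>. max_slope_sq s a \<omega> \<partial>P) \<le> ennreal (4 * C * \<delta> ^ 3 / (a - s))"
    by (rule max_slope_sq_integral[OF s anchor])
  also have "4 * C * \<delta> ^ 3 / (a - s) \<le> 4 * C * y\<^sup>2"
    using mult_left_mono[OF y(2), of "4 * C"] C s by (simp add: divide_le_eq mult_ac)
  finally have int: "(\<integral>\<^sup>+\<omega>. max_slope_sq s a \<omega> \<partial>P) \<le> ennreal (4 * C * y\<^sup>2)"
    by (simp add: ennreal_leI)
  have "(L * \<delta>)\<^sup>2 \<le> (L * y)\<^sup>2" using L y \<delta> by (intro power_mono mult_left_mono) auto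
  then have L': "8 * (L * \<delta>)\<^sup>2 \<le> 8 * L\<^sup>2 * y\<^sup>2" by (simp add: power_mult_distrib)
  have "(\<integral>\<^sup>+\<omega>. cell_bound s a y \<omega> \<partial>P) = ennreal (y powr p) +
     ennreal (y powr (p - 2)) * (2 * (\<integral>\<^sup>+\<omega>. max_slope_sq s a \<omega> \<partial>P) + ennreal (8 * (L * \<delta>)\<^sup>2))"
    unfolding cell_bound_def
    by (simp add: nn_integral_add nn_integral_cmult emeasure_space_1)
  also have "\<dots> \<le> ennreal (y powr p) +
     ennreal (y powr (p - 2)) * (2 * ennreal (4 * C * y\<^sup>2) + ennreal (8 * L\<^sup>2 * y\<^sup>2))"
    using int L' by (intro add_mono mult_left_mono ennreal_leI) auto
  also have "2 * ennreal (4 * C * y\<^sup>2) = ennreal (8 * C * y\<^sup>2)"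
    using C by (simp add: ennreal_mult[symmetric] flip: ennreal_numeral)
  also have "ennreal (y powr p) + ennreal (y powr (p - 2)) * (ennreal (8 * C * y\<^sup>2) + ennreal (8 * L\<^sup>2 * y\<^sup>2))
     = ennreal (y powr p + y powr (p - 2) * (8 * C * y\<^sup>2 + 8 * L\<^sup>2 * y\<^sup>2))"
    using C by (simp add: ennreal_mult[symmetric] flip: ennreal_plus)
  also have "y powr p + y powr (p - 2) * (8 * C * y\<^sup>2 + 8 * L\<^sup>2 * y\<^sup>2)
     = y powr p + (y powr (p - 2) * y\<^sup>2) * (8 * C + 8 * L\<^sup>2)"
    by (simp add: algebra_simps)
  also have "y powr (p - 2) * y\<^sup>2 = y powr p"
    using y \<delta> by (simp add: powr_numeral[symmetric] powr_add[symmetric] del: powr_numeral)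
  finally show ?thesis by (simp add: algebra_simps)
qed

text \<open>If \<open>Z\<^sup>2\<close> is the supremum, \<open>tangent\<close> keeps
  \<open>F\<close> to the right of \<open>a\<close> below the line of slope \<open>l s + Z\<close>
  through its point over \<open>s\<close>, so \<open>supporting_slope_le\<close> gives
  \<open>h \<le> l s + Z\<close>. Replacing \<open>l s\<close> by \<open>l t\<close> costs at most
  \<open>2 * L * \<delta>\<close>.\<close>

lemma cell_bound_upper:
  assumes s: "0 \<le> s" "s < a" and t: "a < t" "t \<le> 1" "t - s \<le> 2 * \<delta>" and y: "0 < y"
    and \<omega>: "\<omega> \<in> space P" and h: "supporting_slope (F \<omega>) t h"
  shows "ennreal ((max 0 (h - l t)) powr p) \<le> cell_bound s a y \<omega>"
proof (cases "max_slope_sq s a \<omega>")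
  \<comment> \<open>As \<open>y > 0\<close>, the coefficient of the infinite term is nonzero and the
    bound is infinite too.\<close>
  case top
  then show ?thesis using y by (simp add: cell_bound_def ennreal_mult_top)
next
  case (real z)
  define Z where "Z = sqrt z"
  have z: "z = Z\<^sup>2" "0 \<le> Z" using real by (simp_all add: Z_def)
  have "h \<le> l s + Z"
  proof (rule supporting_slope_le[OF F_approximable[OF \<omega>] h, of s a])
    fix d assume d: "d \<in> {0..1} \<inter> \<rat>" "a \<le> d"
    have "ennreal (((M \<omega> d - M \<omega> s) / (d - s))\<^sup>2) \<le> max_slope_sq s a \<omega>"
      unfolding max_slope_sq_def by (rule SUP_upper) (use d in auto)
    then have "((M \<omega> d - M \<omega> s) / (d - s))\<^sup>2 \<le> Z\<^sup>2"
      using real z by simp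
    then have "(M \<omega> d - M \<omega> s) / (d - s) \<le> Z"
      using z(2) power2_le_imp_le by blast
    then have "M \<omega> d - M \<omega> s \<le> Z * (d - s)"
      using d s by (simp add: divide_le_eq)
    moreover have "A d - A s \<le> l s * (d - s)"
      using d s t by (intro tangent) auto
    ultimately show "F \<omega> d \<le> F \<omega> s + (l s + Z) * (d - s)"
      by (simp add: M_def algebra_simps)
  qed (use s t in auto)
  moreover have "l s - l t \<le> L * (2 * \<delta>)"
  proof -
    have "l s - l t \<le> L * \<bar>s - t\<bar>" using lipschitz[of s t] s t by auto
    also have "\<dots> \<le> L * (2 * \<delta>)" using s t L by (intro mult_left_mono) auto
    finally show ?thesis .
  qed
  ultimately have "max 0 (h - l t) \<le> Z + 2 * (L * \<delta>)" (is "_ \<le> ?w")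
    using z(2) L \<delta> by (auto simp: max_def)
  then have "(max 0 (h - l t)) powr p \<le> ?w powr p"
    using p by (intro powr_mono2) auto
  also have "\<dots> \<le> y powr p + y powr (p - 2) * ?w\<^sup>2"
    using z(2) L \<delta> y p by (intro powr_le_truncated_square) auto
  also have "\<dots> \<le> y powr p + y powr (p - 2) * (2 * z + 8 * (L * \<delta>)\<^sup>2)"
  proof -
    \<comment> \<open>The square of a sum is at most twice the sum of the squares; this is the
      origin of the constants 2 and 8 in \<open>cell_bound\<close>.\<close>
    have "?w\<^sup>2 \<le> 2 * z + 8 * (L * \<delta>)\<^sup>2"
      using zero_le_power2[of "Z - 2 * (L * \<delta>)"] unfolding z by (simp add: power2_eq_square algebra_simps)
    then show ?thesis by (intro add_left_mono mult_left_mono) auto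
  qed
  finally have "ennreal ((max 0 (h - l t)) powr p) \<le>
      ennreal (y powr p + y powr (p - 2) * (2 * z + 8 * (L * \<delta>)\<^sup>2))"
    by (rule ennreal_leI)
  also have "\<dots> = cell_bound s a y \<omega>"
  proof -
    have "ennreal (2 * z) = 2 * ennreal z" using real by (simp add: ennreal_mult flip: ennreal_numeral)
    then show ?thesis
      unfolding cell_bound_def real(2) using real(1) by (simp add: ennreal_mult ennreal_plus)
  qed
  finally show ?thesis .
qed

text \<open>\<open>q\<close> is the ratio of the geometric series over the cells accumulating at 0; it is below 1
  exactly because \<open>p < 2\<close>.\<close>

definition K :: real where "K = 1 + 8 * C + 8 * L\<^sup>2"
definition q :: real where "q = 2 powr p / 4"

lemma K_pos: "0 < K" using C by (simp add: K_def add_pos_nonneg)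

lemma q_bounds: "0 < q" "q < 1"
proof -
  have "2 powr p < 2 powr (2::real)" using p by (intro powr_less_mono) auto
  then show "0 < q" "q < 1" by (simp_all add: q_def)
qed

section \<open>Summation over the cells\<close>

text \<open>All cells use the anchor 0, where increments are controlled at every scale. From one
  cell to the next the length shrinks by 4 while \<open>y j powr p\<close> grows by
  \<open>2 powr p\<close>, which gives a geometric series of ratio \<open>q\<close>.\<close>

lemma upper_bound_near_0:
  obtains W :: "'a \<Rightarrow> real \<Rightarrow> ennreal" where "\<And>\<omega>. W \<omega> \<in> borel_measurable lborel"
    and "(\<lambda>\<omega>. \<integral>\<^sup>+t. W \<omega> t \<partial>lborel) \<in> borel_measurable P"
    and "(\<integral>\<^sup>+\<omega>. (\<integral>\<^sup>+t. W \<omega> t \<partial>lborel) \<partial>P) \<le> ennreal (3 * q / (1 - q) * K * \<delta> powr p)"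
    and "\<And>\<omega> t h. \<omega> \<in> space P \<Longrightarrow> 0 < t \<Longrightarrow> t \<le> \<delta> \<Longrightarrow> supporting_slope (F \<omega>) t h \<Longrightarrow>
           ennreal ((max 0 (h - l t)) powr p) \<le> W \<omega> t"
proof -
  \<comment> \<open>\<open>y j\<close> is the order of the error at distance \<open>\<delta> / 4 ^ Suc j\<close> from 0, as \<open>\<delta> ^ 3\<close> is \<open>1 / n\<close>.\<close>
  define a b y where "a j = \<delta> / 4 ^ Suc j" and "b j = \<delta> / 4 ^ j" and "y j = 2 ^ Suc j * \<delta>" for j :: nat
  have a: "0 < a j" "a j \<le> b j" "b j \<le> \<delta>" for j
    using \<delta> by (auto simp: a_def b_def divide_simps)
  have y: "\<delta> \<le> y j" for j
    using \<delta> by (simp add: y_def mult_le_cancel_right1 one_le_power del: power_Suc)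
  \<comment> \<open>Equality holds: \<open>y j\<close> is exactly the noise level for slopes from 0
    to points beyond \<open>a j\<close>.\<close>
  have y2: "\<delta> ^ 3 \<le> (y j)\<^sup>2 * (a j - 0)" for j
  proof -
    have "(2 ^ i)\<^sup>2 = (4::real) ^ i" for i by (induction i) (auto simp: power2_eq_square)
    then have "(y j)\<^sup>2 = 4 ^ Suc j * \<delta>\<^sup>2"
      by (simp only: y_def power_mult_distrib)
    then show ?thesis
      by (simp only: a_def) (simp add: power2_eq_square power3_eq_cube del: power_Suc)
  qed
  have term_eq: "(b j - a j) * (K * y j powr p) = 3 * q * K * \<delta> * \<delta> powr p * q ^ j" for j
  proof -
    have "y j powr p = (2 powr p) ^ Suc j * \<delta> powr p"
      using \<delta> by (simp add: y_def powr_mult powr_power powr_realpow[symmetric] powr_powr mult.commute del: power_Suc)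
    moreover have "(2 powr p) ^ Suc j = q ^ Suc j * 4 ^ Suc j"
      by (simp add: q_def power_divide)
    moreover have "b j - a j = 3 * \<delta> / 4 ^ Suc j" by (simp add: a_def b_def field_simps)
    ultimately show ?thesis by simp
  qed
  have sums: "(\<lambda>j. (b j - a j) * (K * y j powr p)) sums (3 * q * K * \<delta> * \<delta> powr p * (1 / (1 - q)))"
    unfolding term_eq using q_bounds by (intro sums_mult geometric_sums) auto
  obtain W :: "'a \<Rightarrow> real \<Rightarrow> ennreal" where W: "\<And>\<omega>. W \<omega> \<in> borel_measurable lborel"
    "(\<lambda>\<omega>. \<integral>\<^sup>+t. W \<omega> t \<partial>lborel) \<in> borel_measurable P"
    and int: "(\<integral>\<^sup>+\<omega>. (\<integral>\<^sup>+t. W \<omega> t \<partial>lborel) \<partial>P) \<le> ennreal (3 * q * K * \<delta> * \<delta> powr p * (1 / (1 - q)))"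
    and upper: "\<And>j \<omega> t. a j < t \<Longrightarrow> t \<le> b j \<Longrightarrow> cell_bound 0 (a j) (y j) \<omega> \<le> W \<omega> t"
  proof (rule step_majorant[of "\<lambda>j. cell_bound 0 (a j) (y j)" P a b "\<lambda>j. K * y j powr p"])
    fix j
    show "cell_bound 0 (a j) (y j) \<in> borel_measurable P"
      using a[of j] \<delta> by (intro cell_bound_measurable) auto
    show "(\<integral>\<^sup>+\<omega>. cell_bound 0 (a j) (y j) \<omega> \<partial>P) \<le> ennreal (K * y j powr p)"
      unfolding K_def using a[of j] \<delta> y y2 by (intro cell_bound_integral) auto
  qed (use sums a K_pos in auto)
  show thesis
  proof (rule that[OF W])
    \<comment> \<open>The spare factor \<open>\<delta>\<close>, from the length of
      \<open>(0, \<delta>]\<close>, is bounded by 1.\<close>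
    have "3 * q * K * \<delta> * \<delta> powr p * (1 / (1 - q)) \<le> 3 * q * K * 1 * \<delta> powr p * (1 / (1 - q))"
      using \<delta> q_bounds K_pos by (intro mult_right_mono mult_left_mono) auto
    with int show "(\<integral>\<^sup>+\<omega>. (\<integral>\<^sup>+t. W \<omega> t \<partial>lborel) \<partial>P) \<le> ennreal (3 * q / (1 - q) * K * \<delta> powr p)"
      by (elim order_trans) (intro ennreal_leI, simp add: field_simps)
  next
    fix \<omega> t h assume *: "\<omega> \<in> space P" "0 < t" "t \<le> \<delta>" "supporting_slope (F \<omega>) t h"
    then have "1 \<le> \<delta> / t" by simp
    then obtain j where "4 ^ j \<le> \<delta> / t" "\<delta> / t < 4 ^ Suc j"
      using power_bracket[of 4 "\<delta> / t"] by auto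
    then have j: "a j < t" "t \<le> b j"
      using * by (auto simp: a_def b_def field_simps)
    have "ennreal ((max 0 (h - l t)) powr p) \<le> cell_bound 0 (a j) (y j) \<omega>"
      using * j a[of j] \<delta> y[of j] by (intro cell_bound_upper) auto
    also have "\<dots> \<le> W \<omega> t" using j by (rule upper)
    finally show "ennreal ((max 0 (h - l t)) powr p) \<le> W \<omega> t" .
  qed
qed

text \<open>Each cell has length \<open>\<delta>\<close> and its anchor lies \<open>\<delta>\<close>
  before its left end, the smallest distance allowed at interior points. At most
  \<open>1 / \<delta>\<close> cells contribute \<open>\<delta> * K * \<delta> powr p\<close>
  each.\<close>

lemma upper_bound_away_from_0:
  obtains W :: "'a \<Rightarrow> real \<Rightarrow> ennreal" where "\<And>\<omega>. W \<omega> \<in> borel_measurable lborel"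
    and "(\<lambda>\<omega>. \<integral>\<^sup>+t. W \<omega> t \<partial>lborel) \<in> borel_measurable P"
    and "(\<integral>\<^sup>+\<omega>. (\<integral>\<^sup>+t. W \<omega> t \<partial>lborel) \<partial>P) \<le> ennreal (K * \<delta> powr p)"
    and "\<And>\<omega> t h. \<omega> \<in> space P \<Longrightarrow> \<delta> < t \<Longrightarrow> t \<le> 1 \<Longrightarrow> supporting_slope (F \<omega>) t h \<Longrightarrow>
           ennreal ((max 0 (h - l t)) powr p) \<le> W \<omega> t"
proof -
  \<comment> \<open>The shift by \<open>Suc\<close> starts the cells at \<open>\<delta>\<close>, so
    that the anchors \<open>a j - \<delta>\<close> stay nonnegative.\<close>
  define a where "a j = real (Suc j) * \<delta>" for j
  define J where "J = {j. a j < 1}"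
  define R where "R j = (if j \<in> J then cell_bound (a j - \<delta>) (a j) \<delta> else (\<lambda>_. 0))" for j
  define c where "c j = (if j \<in> J then K * \<delta> powr p else 0)" for j
  have a: "\<delta> \<le> a j" for j using \<delta> by (simp add: a_def)
  have J_sub: "J \<subseteq> {..<nat \<lfloor>1 / \<delta>\<rfloor>}"
  proof
    fix j assume "j \<in> J"
    then have "real (Suc j) \<le> 1 / \<delta>" using \<delta> by (simp add: J_def a_def field_simps)
    then show "j \<in> {..<nat \<lfloor>1 / \<delta>\<rfloor>}" by (simp add: Suc_le_eq[symmetric] le_nat_floor)
  qed
  then have J: "finite J" by (rule finite_subset) simp
  have "real (card J) \<le> real (nat \<lfloor>1 / \<delta>\<rfloor>)"
    using card_mono[OF _ J_sub] by simp
  also have "\<dots> \<le> 1 / \<delta>" using \<delta> by (intro of_nat_floor) simp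
  finally have card: "real (card J) * \<delta> \<le> 1" using \<delta> by (simp add: field_simps)
  have sums: "(\<lambda>j. (a j + \<delta> - a j) * c j) sums (\<Sum>j\<in>J. (a j + \<delta> - a j) * c j)"
    using J by (intro sums_finite) (auto simp: c_def)
  have sum_le: "(\<Sum>j\<in>J. (a j + \<delta> - a j) * c j) \<le> K * \<delta> powr p"
    using mult_right_mono[OF card, of "K * \<delta> powr p"] K_pos by (simp add: c_def mult_ac)
  obtain W :: "'a \<Rightarrow> real \<Rightarrow> ennreal" where W: "\<And>\<omega>. W \<omega> \<in> borel_measurable lborel"
    "(\<lambda>\<omega>. \<integral>\<^sup>+t. W \<omega> t \<partial>lborel) \<in> borel_measurable P"
    and int: "(\<integral>\<^sup>+\<omega>. (\<integral>\<^sup>+t. W \<omega> t \<partial>lborel) \<partial>P) \<le> ennreal (\<Sum>j\<in>J. (a j + \<delta> - a j) * c j)"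
    and upper: "\<And>j \<omega> t. a j < t \<Longrightarrow> t \<le> a j + \<delta> \<Longrightarrow> R j \<omega> \<le> W \<omega> t"
  proof (rule step_majorant[of R P a "\<lambda>j. a j + \<delta>" c])
    fix j
    show "R j \<in> borel_measurable P"
      using a[of j] \<delta> by (auto simp: R_def J_def intro!: cell_bound_measurable)
    show "(\<integral>\<^sup>+\<omega>. R j \<omega> \<partial>P) \<le> ennreal (c j)"
    proof (cases "j \<in> J")
      case True
      have "(\<integral>\<^sup>+\<omega>. cell_bound (a j - \<delta>) (a j) \<delta> \<omega> \<partial>P) \<le> ennreal (K * \<delta> powr p)"
        unfolding K_def using a[of j] \<delta> True
        by (intro cell_bound_integral) (auto simp: J_def power2_eq_square power3_eq_cube)
      then show ?thesis using True by (simp add: R_def c_def)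
    qed (simp add: R_def c_def)
  qed (use sums K_pos \<delta> in \<open>auto simp: c_def\<close>)
  show thesis
  proof (rule that[OF W])
    show "(\<integral>\<^sup>+\<omega>. (\<integral>\<^sup>+t. W \<omega> t \<partial>lborel) \<partial>P) \<le> ennreal (K * \<delta> powr p)"
      using int sum_le by (meson ennreal_leI order_trans)
  next
    fix \<omega> t h assume *: "\<omega> \<in> space P" "\<delta> < t" "t \<le> 1" "supporting_slope (F \<omega>) t h"
    \<comment> \<open>Cells are open on the left, hence the ceiling minus one instead of the floor;
      \<open>\<delta> < t\<close> makes \<open>k\<close> positive.\<close>
    define k where "k = nat (\<lceil>t / \<delta>\<rceil> - 1)"
    have "1 < t / \<delta>" using * \<delta> by simp
    then have ceil: "2 \<le> \<lceil>t / \<delta>\<rceil>" by linarith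
    then obtain j where j: "k = Suc j" unfolding k_def by (cases "nat (\<lceil>t / \<delta>\<rceil> - 1)") auto
    have "real k = of_int \<lceil>t / \<delta>\<rceil> - 1" using ceil by (simp add: k_def)
    then have "real k < t / \<delta>" "t / \<delta> \<le> real k + 1" by linarith+
    then have t: "a j < t" "t \<le> a j + \<delta>"
      using \<delta> by (auto simp: a_def j[symmetric] field_simps)
    then have "j \<in> J" using * by (simp add: J_def)
    have "ennreal ((max 0 (h - l t)) powr p) \<le> cell_bound (a j - \<delta>) (a j) \<delta> \<omega>"
      using * t a[of j] \<delta> by (intro cell_bound_upper) auto
    also have "\<dots> \<le> W \<omega> t" using upper[OF t, of \<omega>] \<open>j \<in> J\<close> by (simp add: R_def)
    finally show "ennreal ((max 0 (h - l t)) powr p) \<le> W \<omega> t" .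
  qed
qed

lemma upper_bound:
  obtains W :: "'a \<Rightarrow> real \<Rightarrow> ennreal" where "\<And>\<omega>. W \<omega> \<in> borel_measurable lborel"
    and "(\<lambda>\<omega>. \<integral>\<^sup>+t. W \<omega> t \<partial>lborel) \<in> borel_measurable P"
    and "(\<integral>\<^sup>+\<omega>. (\<integral>\<^sup>+t. W \<omega> t \<partial>lborel) \<partial>P) \<le> ennreal ((3 * q / (1 - q) + 1) * K * \<delta> powr p)"
    and "\<And>\<omega> t h. \<omega> \<in> space P \<Longrightarrow> 0 < t \<Longrightarrow> t \<le> 1 \<Longrightarrow> supporting_slope (F \<omega>) t h \<Longrightarrow>
           ennreal ((max 0 (h - l t)) powr p) \<le> W \<omega> t"
proof -
  obtain V :: "'a \<Rightarrow> real \<Rightarrow> ennreal" where V[measurable]: "\<And>\<omega>. V \<omega> \<in> borel_measurable lborel"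
    "(\<lambda>\<omega>. \<integral>\<^sup>+t. V \<omega> t \<partial>lborel) \<in> borel_measurable P"
    and V_int: "(\<integral>\<^sup>+\<omega>. (\<integral>\<^sup>+t. V \<omega> t \<partial>lborel) \<partial>P) \<le> ennreal (3 * q / (1 - q) * K * \<delta> powr p)"
    and V_upper: "\<And>\<omega> t h. \<omega> \<in> space P \<Longrightarrow> 0 < t \<Longrightarrow> t \<le> \<delta> \<Longrightarrow> supporting_slope (F \<omega>) t h \<Longrightarrow>
           ennreal ((max 0 (h - l t)) powr p) \<le> V \<omega> t"
    by (rule upper_bound_near_0, rule that)
  obtain W :: "'a \<Rightarrow> real \<Rightarrow> ennreal" where W[measurable]: "\<And>\<omega>. W \<omega> \<in> borel_measurable lborel"
    "(\<lambda>\<omega>. \<integral>\<^sup>+t. W \<omega> t \<partial>lborel) \<in> borel_measurable P"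
    and W_int: "(\<integral>\<^sup>+\<omega>. (\<integral>\<^sup>+t. W \<omega> t \<partial>lborel) \<partial>P) \<le> ennreal (K * \<delta> powr p)"
    and W_upper: "\<And>\<omega> t h. \<omega> \<in> space P \<Longrightarrow> \<delta> < t \<Longrightarrow> t \<le> 1 \<Longrightarrow> supporting_slope (F \<omega>) t h \<Longrightarrow>
           ennreal ((max 0 (h - l t)) powr p) \<le> W \<omega> t"
    by (rule upper_bound_away_from_0, rule that)
  have eq: "(\<integral>\<^sup>+t. V \<omega> t + W \<omega> t \<partial>lborel) = (\<integral>\<^sup>+t. V \<omega> t \<partial>lborel) + (\<integral>\<^sup>+t. W \<omega> t \<partial>lborel)" for \<omega>
    by (rule nn_integral_add) auto
  show thesis
  proof (rule that[of "\<lambda>\<omega> t. V \<omega> t + W \<omega> t"])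
    show "(\<lambda>\<omega>. \<integral>\<^sup>+t. V \<omega> t + W \<omega> t \<partial>lborel) \<in> borel_measurable P"
      unfolding eq by measurable
    have "(\<integral>\<^sup>+\<omega>. (\<integral>\<^sup>+t. V \<omega> t + W \<omega> t \<partial>lborel) \<partial>P) =
        (\<integral>\<^sup>+\<omega>. (\<integral>\<^sup>+t. V \<omega> t \<partial>lborel) \<partial>P) + (\<integral>\<^sup>+\<omega>. (\<integral>\<^sup>+t. W \<omega> t \<partial>lborel) \<partial>P)"
      unfolding eq by (rule nn_integral_add) auto
    also have "\<dots> \<le> ennreal (3 * q / (1 - q) * K * \<delta> powr p) + ennreal (K * \<delta> powr p)"
      using V_int W_int by (rule add_mono)
    also have "\<dots> = ennreal ((3 * q / (1 - q) + 1) * K * \<delta> powr p)"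
      using q_bounds K_pos by (subst ennreal_plus[symmetric]) (auto simp: algebra_simps)
    finally show "(\<integral>\<^sup>+\<omega>. (\<integral>\<^sup>+t. V \<omega> t + W \<omega> t \<partial>lborel) \<partial>P) \<le>
        ennreal ((3 * q / (1 - q) + 1) * K * \<delta> powr p)" .
  next
    fix \<omega> t h assume "\<omega> \<in> space P" "0 < t" "t \<le> 1" "supporting_slope (F \<omega>) t h"
    then show "ennreal ((max 0 (h - l t)) powr p) \<le> V \<omega> t + W \<omega> t"
      using V_upper[of \<omega> t h] W_upper[of \<omega> t h]
      by (cases "t \<le> \<delta>") (auto intro: add_increasing add_increasing2)
  qed auto
qed

section \<open>Reflection and the two-sided error\<close>

text \<open>The reflection swaps the endpoints 0 and 1, carries annuli around \<open>t\<close> to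
  annuli around \<open>1 - t\<close>, and turns the supergradient \<open>l\<close> of
  \<open>A\<close> into \<open>- l (1 - u)\<close>.\<close>

lemma reflect: "increment_bound P (\<lambda>\<omega> u. F \<omega> (1 - u)) (\<lambda>u. A (1 - u)) (\<lambda>u. - l (1 - u)) C L p \<delta>"
proof
  show "(\<lambda>\<omega>. F \<omega> (1 - t)) \<in> borel_measurable P" if "t \<in> {0..1}" for t
    using that by (intro F_measurable) auto
  show "rationally_approximable (\<lambda>u. F \<omega> (1 - u))" if "\<omega> \<in> space P" for \<omega>
    using that by (intro rationally_approximable_reflect F_approximable)
  show "A (1 - u) - A (1 - s) \<le> - l (1 - s) * (u - s)" if "s \<in> {0..1}" "u \<in> {0..1}" for s u
    using tangent[of "1 - s" "1 - u"] that by (simp add: algebra_simps)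
  show "\<bar>- l (1 - s) - - l (1 - t)\<bar> \<le> L * \<bar>s - t\<bar>" if "s \<in> {0..1}" "t \<in> {0..1}" for s t
    using lipschitz[of "1 - s" "1 - t"] that by (simp add: abs_minus_commute)
  fix t x :: real assume t: "t \<in> {0..1}" "\<delta> \<le> x \<or> 0 < x \<and> t \<in> {0, 1}"
  have "(\<integral>\<^sup>+\<omega>. (SUP u\<in>{u\<in>{0..1}. x / 2 \<le> \<bar>t - u\<bar> \<and> \<bar>t - u\<bar> \<le> x}.
         ennreal (((F \<omega> (1 - u) - A (1 - u)) - (F \<omega> (1 - t) - A (1 - t)))\<^sup>2)) \<partial>P) \<le>
      (\<integral>\<^sup>+\<omega>. (SUP u\<in>{u\<in>{0..1}. x / 2 \<le> \<bar>(1 - t) - u\<bar> \<and> \<bar>(1 - t) - u\<bar> \<le> x}.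
         ennreal (((F \<omega> u - A u) - (F \<omega> (1 - t) - A (1 - t)))\<^sup>2)) \<partial>P)"
  proof (intro nn_integral_mono SUP_least)
    fix \<omega> u assume u: "u \<in> {u\<in>{0..1}. x / 2 \<le> \<bar>t - u\<bar> \<and> \<bar>t - u\<bar> \<le> x}"
    show "ennreal (((F \<omega> (1 - u) - A (1 - u)) - (F \<omega> (1 - t) - A (1 - t)))\<^sup>2) \<le>
      (SUP u\<in>{u\<in>{0..1}. x / 2 \<le> \<bar>(1 - t) - u\<bar> \<and> \<bar>(1 - t) - u\<bar> \<le> x}.
         ennreal (((F \<omega> u - A u) - (F \<omega> (1 - t) - A (1 - t)))\<^sup>2))"
      by (rule SUP_upper) (use u in \<open>auto simp: abs_minus_commute\<close>)
  qed
  also have "\<dots> \<le> ennreal (C * x * \<delta> ^ 3)" using t by (intro moment) auto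
  finally show "(\<integral>\<^sup>+\<omega>. (SUP u\<in>{u\<in>{0..1}. x / 2 \<le> \<bar>t - u\<bar> \<and> \<bar>t - u\<bar> \<le> x}.
         ennreal (((F \<omega> (1 - u) - A (1 - u)) - (F \<omega> (1 - t) - A (1 - t)))\<^sup>2)) \<partial>P) \<le>
      ennreal (C * x * \<delta> ^ 3)" .
qed (use C L p \<delta> in auto)

text \<open>Where \<open>h\<close> exceeds \<open>l\<close> the error is bounded by \<open>V\<close>
  at \<open>t\<close>, elsewhere by the majorant \<open>W\<close> of the reflected problem at
  \<open>1 - t\<close>. The two endpoints form a null set.\<close>

lemma expected_Lp_error:
  assumes h: "\<And>\<omega> t. \<omega> \<in> space P \<Longrightarrow> 0 < t \<Longrightarrow> t < 1 \<Longrightarrow> supporting_slope (F \<omega>) t (h \<omega> t)"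
  shows "(\<integral>\<^sup>+\<omega>. (\<integral>\<^sup>+t\<in>{0..1}. ennreal (\<bar>h \<omega> t - l t\<bar> powr p) \<partial>lborel) \<partial>P) \<le>
    ennreal (2 * (3 * q / (1 - q) + 1) * K * \<delta> powr p)"
proof -
  let ?B = "(3 * q / (1 - q) + 1) * K * \<delta> powr p"
  interpret refl: increment_bound P "\<lambda>\<omega> u. F \<omega> (1 - u)" "\<lambda>u. A (1 - u)" "\<lambda>u. - l (1 - u)" C L p \<delta>
    by (rule reflect)
  obtain V :: "'a \<Rightarrow> real \<Rightarrow> ennreal" where V[measurable]: "\<And>\<omega>. V \<omega> \<in> borel_measurable lborel"
    "(\<lambda>\<omega>. \<integral>\<^sup>+t. V \<omega> t \<partial>lborel) \<in> borel_measurable P"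
    and V_int: "(\<integral>\<^sup>+\<omega>. (\<integral>\<^sup>+t. V \<omega> t \<partial>lborel) \<partial>P) \<le> ennreal ?B"
    and V_upper: "\<And>\<omega> t h. \<omega> \<in> space P \<Longrightarrow> 0 < t \<Longrightarrow> t \<le> 1 \<Longrightarrow> supporting_slope (F \<omega>) t h \<Longrightarrow>
           ennreal ((max 0 (h - l t)) powr p) \<le> V \<omega> t"
    by (rule upper_bound, rule that)
  obtain W :: "'a \<Rightarrow> real \<Rightarrow> ennreal" where W[measurable]: "\<And>\<omega>. W \<omega> \<in> borel_measurable lborel"
    "(\<lambda>\<omega>. \<integral>\<^sup>+t. W \<omega> t \<partial>lborel) \<in> borel_measurable P"
    and W_int: "(\<integral>\<^sup>+\<omega>. (\<integral>\<^sup>+t. W \<omega> t \<partial>lborel) \<partial>P) \<le> ennreal ?B"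
    and W_upper: "\<And>\<omega> t h. \<omega> \<in> space P \<Longrightarrow> 0 < t \<Longrightarrow> t \<le> 1 \<Longrightarrow>
           supporting_slope (\<lambda>u. F \<omega> (1 - u)) t h \<Longrightarrow>
           ennreal ((max 0 (h - - l (1 - t))) powr p) \<le> W \<omega> t"
    by (rule refl.upper_bound, rule that)
  have W_refl: "(\<integral>\<^sup>+t. W \<omega> (1 - t) \<partial>lborel) = (\<integral>\<^sup>+t. W \<omega> t \<partial>lborel)" for \<omega>
    using nn_integral_real_affine[of "W \<omega>" "-1" 1] W(1)[of \<omega>] by simp
  have "(\<integral>\<^sup>+t\<in>{0..1}. ennreal (\<bar>h \<omega> t - l t\<bar> powr p) \<partial>lborel) \<le>
      (\<integral>\<^sup>+t. V \<omega> t \<partial>lborel) + (\<integral>\<^sup>+t. W \<omega> t \<partial>lborel)" if \<omega>: "\<omega> \<in> space P" for \<omega>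
  proof -
    have bound: "ennreal (\<bar>h \<omega> t - l t\<bar> powr p) * indicator {0..1} t \<le> V \<omega> t + W \<omega> (1 - t)"
      if "t \<noteq> 0" "t \<noteq> 1" for t
    proof (cases "0 < t \<and> t < 1")
      case True
      then have s: "supporting_slope (F \<omega>) t (h \<omega> t)" using h \<omega> by auto
      show ?thesis
      proof (cases "l t \<le> h \<omega> t")
        case le: True
        then have "ennreal (\<bar>h \<omega> t - l t\<bar> powr p) \<le> V \<omega> t"
          using V_upper[OF \<omega> _ _ s] True by simp
        then show ?thesis using True by (auto intro: add_increasing2)
      next
        case False
        then have "ennreal (\<bar>h \<omega> t - l t\<bar> powr p) \<le> W \<omega> (1 - t)"
          using W_upper[OF \<omega> _ _ supporting_slope_reflect[OF s]] True by simp
        then show ?thesis using True by (auto intro: add_increasing)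
      qed
    qed (use that in \<open>auto simp: indicator_def\<close>)
    have ae: "AE t in lborel. t \<noteq> (0::real) \<and> t \<noteq> 1"
      using AE_lborel_singleton[of "0::real"] AE_lborel_singleton[of "1::real"] by eventually_elim auto
    \<comment> \<open>Here \<open>h\<close> is an arbitrary function; \<open>nn_integral\<close> is
      monotone without measurability, which only the majorants have to provide.\<close>
    have "(\<integral>\<^sup>+t\<in>{0..1}. ennreal (\<bar>h \<omega> t - l t\<bar> powr p) \<partial>lborel) \<le>
        (\<integral>\<^sup>+t. V \<omega> t + W \<omega> (1 - t) \<partial>lborel)"
      using ae by (intro nn_integral_mono_AE, elim eventually_mono) (use bound in blast)
    also have "\<dots> = (\<integral>\<^sup>+t. V \<omega> t \<partial>lborel) + (\<integral>\<^sup>+t. W \<omega> t \<partial>lborel)"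
      unfolding W_refl[symmetric] by (rule nn_integral_add) auto
    finally show ?thesis .
  qed
  then have "(\<integral>\<^sup>+\<omega>. (\<integral>\<^sup>+t\<in>{0..1}. ennreal (\<bar>h \<omega> t - l t\<bar> powr p) \<partial>lborel) \<partial>P) \<le>
      (\<integral>\<^sup>+\<omega>. (\<integral>\<^sup>+t. V \<omega> t \<partial>lborel) + (\<integral>\<^sup>+t. W \<omega> t \<partial>lborel) \<partial>P)"
    by (rule nn_integral_mono)
  also have "\<dots> = (\<integral>\<^sup>+\<omega>. (\<integral>\<^sup>+t. V \<omega> t \<partial>lborel) \<partial>P) + (\<integral>\<^sup>+\<omega>. (\<integral>\<^sup>+t. W \<omega> t \<partial>lborel) \<partial>P)"
    by (rule nn_integral_add) auto
  also have "\<dots> \<le> ennreal ?B + ennreal ?B" using V_int W_int by (rule add_mono)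
  also have "\<dots> = ennreal (2 * (3 * q / (1 - q) + 1) * K * \<delta> powr p)"
    using q_bounds K_pos by (subst ennreal_plus[symmetric]) auto
  finally show ?thesis .
qed

end

section \<open>The rate of convergence\<close>

text \<open>A nonincreasing \<open>l\<close> is at most \<open>l s\<close> to the right of
  \<open>s\<close> and at least \<open>l s\<close> to the left; integrating gives the same
  inequality on both sides.\<close>

lemma integral_tangent_bound:
  fixes l :: "real \<Rightarrow> real"
  assumes l: "continuous_on {0..1} l" "antimono_on {0..1} l"
    and s: "s \<in> {0..1}" and u: "u \<in> {0..1}"
  shows "integral {0..u} l - integral {0..s} l \<le> l s * (u - s)"
proof -
  have int: "l integrable_on {a..b}" if "0 \<le> a" "b \<le> 1" for a b
    using l(1) that by (intro integrable_continuous_real continuous_on_subset[OF l(1)]) auto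
  have split: "integral {0..b} l - integral {0..a} l = integral {a..b} l"
    if "0 \<le> a" "a \<le> b" "b \<le> 1" for a b
    using Henstock_Kurzweil_Integration.integral_combine[of 0 a b l] int[of 0 b] that by simp
  have const: "integral {a..b} (\<lambda>_. l s) = l s * (b - a)" if "a \<le> b" for a b
    using that by simp
  show ?thesis
  proof (cases "s \<le> u")
    case True
    have "integral {s..u} l \<le> integral {s..u} (\<lambda>_. l s)"
      using s u monotone_onD[OF l(2)] by (intro integral_le int) auto
    then show ?thesis using split[of s u] const[of s u] s u True by (simp add: mult.commute)
  next
    case False
    have "integral {u..s} (\<lambda>_. l s) \<le> integral {u..s} l"
      using s u monotone_onD[OF l(2)] by (intro integral_le int) auto
    then show ?thesis using split[of u s] const[of u s] s u False by (simp add: algebra_simps)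
  qed
qed

theorem corollary1:
  fixes P :: "'a measure"
    and lam lam' :: "real \<Rightarrow> real"
    and Lam :: "real \<Rightarrow> real"
    and Lam_n :: "nat \<Rightarrow> 'a \<Rightarrow> real \<Rightarrow> real"
    and M_n :: "nat \<Rightarrow> 'a \<Rightarrow> real \<Rightarrow> real"
    and lam_hat :: "nat \<Rightarrow> 'a \<Rightarrow> real \<Rightarrow> real"
    and E :: "nat \<Rightarrow> ennreal"
    and C p :: real
  assumes "prob_space P"
    and "mono_on {0..1} lam \<or> antimono_on {0..1} lam"
    and "\<And>t. t \<in> {0..1} \<Longrightarrow> (lam has_field_derivative lam' t) (at t within {0..1})"
    and "(INF t\<in>{0..1}. \<bar>lam' t\<bar>) > 0"
    and "bdd_above ((\<lambda>t. \<bar>lam' t\<bar>) ` {0..1})"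
    and "\<And>t. t \<in> {0..1} \<Longrightarrow> Lam t = integral {0..t} lam"
    and "\<And>n. n \<ge> 1 \<Longrightarrow> cadlag_step_process P (Lam_n n)"
    and "\<And>n \<omega> t. M_n n \<omega> t = Lam_n n \<omega> t - Lam t"
    and "\<And>n \<omega>. lam_hat n \<omega> = monotone_estimator lam (Lam_n n \<omega>)"
    and "C > 0"
    and "\<And>n x t. n \<ge> 1 \<Longrightarrow> t \<in> {0..1} \<Longrightarrow>
           x \<ge> real n powr (-1/3) \<or> (x > 0 \<and> t \<in> {0, 1}) \<Longrightarrow>
           (\<integral>\<^sup>+\<omega>. (SUP u\<in>{u\<in>{0..1}. x / 2 \<le> \<bar>t - u\<bar> \<and> \<bar>t - u\<bar> \<le> x}.
                    ennreal ((M_n n \<omega> u - M_n n \<omega> t)\<^sup>2)) \<partial>P)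
             \<le> ennreal (C * x / real n)"
    and "1 \<le> p" and "p < 2"
    and "\<And>n. E n = (\<integral>\<^sup>+\<omega>. (\<integral>\<^sup>+t\<in>{0..1}.
           ennreal (\<bar>lam_hat n \<omega> t - lam t\<bar> powr p) \<partial>lborel) \<partial>P)"
  shows "(\<forall>\<^sub>F n in sequentially. E n < \<infinity>) \<and>
         (\<lambda>n. enn2real (E n)) \<in> O(\<lambda>n. real n powr (-p/3))"
proof -
  interpret prob_space P by fact
  note moment = assms(11)
  obtain L where L: "\<forall>t\<in>{0..1}. \<bar>lam' t\<bar> \<le> L"
    using assms(5) by (auto simp: bdd_above_def)
  have L_nonneg: "0 \<le> L" using L by force
  have lip: "\<bar>lam s - lam t\<bar> \<le> L * \<bar>s - t\<bar>" if "s \<in> {0..1}" "t \<in> {0..1}" for s t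
    using field_differentiable_bound[of "{0..1}" lam lam' L s t] assms(3) L that by simp
  have cont: "continuous_on {0..1} lam"
    using assms(3) by (intro DERIV_continuous_on)
  \<comment> \<open>The sign reduces both cases to a nonincreasing function. It follows the same
    test as \<open>monotone_estimator\<close>, so it matches the envelope in use.\<close>
  define \<sigma> :: real where "\<sigma> = (if antimono_on {0..1} lam then 1 else - 1)"
  have \<sigma>: "\<bar>\<sigma>\<bar> = 1" by (simp add: \<sigma>_def)
  have anti: "antimono_on {0..1} (\<lambda>t. \<sigma> * lam t)"
    using assms(2) by (auto simp: \<sigma>_def monotone_on_def)
  have tangent: "\<sigma> * Lam u - \<sigma> * Lam s \<le> \<sigma> * lam s * (u - s)" if "s \<in> {0..1}" "u \<in> {0..1}" for s u
    using integral_tangent_bound[OF _ anti that] cont assms(6)[OF that(1)] assms(6)[OF that(2)]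
    by (simp add: continuous_on_mult_left)
  \<comment> \<open>The locale constants depend only on \<open>p\<close>, \<open>C\<close> and
    \<open>L\<close>, not on \<open>\<delta>\<close>, so one \<open>B\<close> serves all
    \<open>n\<close>.\<close>
  define B where "B = 2 * (3 * increment_bound.q p / (1 - increment_bound.q p) + 1) * increment_bound.K C L"
  have E_le: "E n \<le> ennreal (B * real n powr (-p/3))" if n: "1 \<le> n" for n
  proof -
    \<comment> \<open>At this scale the drift, of order \<open>\<delta>\<close>, balances the noise,
      of order \<open>1 / sqrt (n * \<delta>)\<close>.\<close>
    define \<delta> where "\<delta> = real n powr (-1/3)"
    have \<delta>: "0 < \<delta>" "\<delta> \<le> 1"
      using n powr_mono[of "-1/3" 0 "real n"] by (simp_all add: \<delta>_def)
    have \<delta>3: "\<delta> ^ 3 = 1 / real n"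
    proof -
      have "\<delta> ^ 3 = \<delta> powr 3" using \<delta>(1) by simp
      also have "\<dots> = real n powr (-1)" by (simp add: \<delta>_def powr_powr del: powr_numeral)
      also have "\<dots> = 1 / real n" using n by (simp add: powr_minus_divide)
      finally show ?thesis .
    qed
    have \<delta>p: "\<delta> powr p = real n powr (-p/3)"
      by (simp add: \<delta>_def powr_powr)
    have step: "cadlag_step_process P (Lam_n n)" using assms(7) n .
    have appr: "rationally_approximable (Lam_n n \<omega>)" if "\<omega> \<in> space P" for \<omega>
      using step that by (auto simp: cadlag_step_process_def intro: cadlag_rationally_approximable)
    interpret increment_bound P "\<lambda>\<omega> u. \<sigma> * Lam_n n \<omega> u" "\<lambda>u. \<sigma> * Lam u" "\<lambda>u. \<sigma> * lam u" C L p \<delta>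
    proof
      show "(\<lambda>\<omega>. \<sigma> * Lam_n n \<omega> t) \<in> borel_measurable P" if "t \<in> {0..1}" for t
        using step that by (auto simp: cadlag_step_process_def intro!: borel_measurable_times)
      show "rationally_approximable (\<lambda>u. \<sigma> * Lam_n n \<omega> u)" if "\<omega> \<in> space P" for \<omega>
        using appr[OF that] rationally_approximable_minus[OF appr[OF that]] by (simp add: \<sigma>_def)
      show "\<bar>\<sigma> * lam s - \<sigma> * lam t\<bar> \<le> L * \<bar>s - t\<bar>" if "s \<in> {0..1}" "t \<in> {0..1}" for s t
        using lip[OF that] \<sigma> by (simp add: right_diff_distrib[symmetric] abs_mult)
      fix t x :: real assume t: "t \<in> {0..1}" "\<delta> \<le> x \<or> 0 < x \<and> t \<in> {0, 1}"
      have "(\<sigma> * Lam_n n \<omega> u - \<sigma> * Lam u - (\<sigma> * Lam_n n \<omega> t - \<sigma> * Lam t))\<^sup>2 =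
          (M_n n \<omega> u - M_n n \<omega> t)\<^sup>2" for \<omega> u
        unfolding assms(8) \<sigma>_def by (simp add: power2_eq_square algebra_simps)
      then show "(\<integral>\<^sup>+\<omega>. (SUP u\<in>{u\<in>{0..1}. x / 2 \<le> \<bar>t - u\<bar> \<and> \<bar>t - u\<bar> \<le> x}.
         ennreal ((\<sigma> * Lam_n n \<omega> u - \<sigma> * Lam u - (\<sigma> * Lam_n n \<omega> t - \<sigma> * Lam t))\<^sup>2)) \<partial>P)
         \<le> ennreal (C * x * \<delta> ^ 3)"
        using moment[OF n t(1), folded \<delta>_def, OF t(2)] by (simp add: \<delta>3)
    qed (use assms(10,12,13) L_nonneg \<delta> tangent in auto)
    have "supporting_slope (\<lambda>u. \<sigma> * Lam_n n \<omega> u) t (\<sigma> * lam_hat n \<omega> t)"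
      if \<omega>: "\<omega> \<in> space P" and t: "0 < t" "t < 1" for \<omega> t
    proof -
      obtain b where b: "\<forall>u\<in>{0..1}. \<bar>Lam_n n \<omega> u\<bar> \<le> b"
        using step \<omega> cadlag_bounded unfolding cadlag_step_process_def by blast
      have "bdd_above (Lam_n n \<omega> ` {0..1})" "bdd_above ((\<lambda>u. - Lam_n n \<omega> u) ` {0..1})"
        using b by (auto intro!: bdd_aboveI[of _ b] simp: abs_le_iff)
      then show ?thesis
        using monotone_estimator_antimono monotone_estimator_not_antimono t
        by (simp add: \<sigma>_def assms(9))
    qed
    then have "(\<integral>\<^sup>+\<omega>. (\<integral>\<^sup>+t\<in>{0..1}. ennreal (\<bar>\<sigma> * lam_hat n \<omega> t - \<sigma> * lam t\<bar> powr p) \<partial>lborel) \<partial>P)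
        \<le> ennreal (2 * (3 * q / (1 - q) + 1) * K * \<delta> powr p)"
      by (rule expected_Lp_error)
    moreover have "\<bar>\<sigma> * lam_hat n \<omega> t - \<sigma> * lam t\<bar> = \<bar>lam_hat n \<omega> t - lam t\<bar>" for \<omega> t
      using \<sigma> by (simp add: right_diff_distrib[symmetric] abs_mult)
    ultimately show ?thesis by (simp add: assms(14) B_def \<delta>p)
  qed
  \<comment> \<open>Finiteness is recorded separately because \<open>enn2real\<close> sends infinity
    to 0.\<close>
  have "E n < \<infinity>" if "1 \<le> n" for n
    using E_le[OF that] ennreal_less_top le_less_trans infinity_ennreal_def by metis
  then have fin: "\<forall>\<^sub>F n in sequentially. E n < \<infinity>"
    using eventually_ge_at_top by (rule eventually_mono[rotated])
  \<comment> \<open>The absolute value supplies the nonnegativity that \<open>enn2real_leI\<close>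
    asks for.\<close>
  have "enn2real (E n) \<le> \<bar>B\<bar> * real n powr (-p/3)" if "1 \<le> n" for n
    using E_le[OF that] by (intro enn2real_leI) (auto elim!: order_trans intro!: ennreal_leI mult_right_mono)
  then have "(\<lambda>n. enn2real (E n)) \<in> O(\<lambda>n. real n powr (-p/3))"
    by (intro bigoI[of _ "\<bar>B\<bar>"] eventually_mono[OF eventually_ge_at_top[of 1]]) auto
  with fin show ?thesis by blast
qed

end
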